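(* Let $(M,d)$ be a separable metric space and let $\mu,\mu_n$ ($n\ge 1$) be probability measures on the Borel $\sigma$-field of $M$. If $\mu_n$ converges weakly to $\mu$, then $\pi(\mu_n,\mu)\to 0$ as $n\to\infty$.
   Context: For $A\subset M$ and $\varepsilon>0$, $A^{\varepsilon}=\{x\in M : \exists\, y\in A \text{ with } d(x,y)<\varepsilon\}$. The Prohorov distance between probability measures $\mu,\nu$ on the Borel $\sigma$-field of $M$ is $$\pi(\mu,\nu)=\inf\{\varepsilon>0 : \mu(A)\le\nu(A^{\varepsilon})+\varepsilon \text{ and } \nu(A)\le\mu(A^{\varepsilon})+\varepsilon \text{ for all closed sets } A\subset M\}.$$ Weak convergence of $\mu_n$ to $\mu$ means $\limsup_{n\to\infty}\mu_n(C)\le\mu(C)$ for every closed set $C\subset M$; equivalently, $\int f\,d\mu_n\to\int f\,d\mu$ for every uniformly continuous $f:M\to[0,1]$. *)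

theory Defs
  imports "HOL-Probability.Probability"
begin

context Metric_space
begin

definition borel_field :: "'a measure" where
  "borel_field = sigma M {U. openin mtopology U}"

text \<open>The strict inequality makes every enlargement open, hence Borel, even if \<open>A\<close> is not.\<close>

definition enlargement :: "'a set \<Rightarrow> real \<Rightarrow> 'a set" where
  "enlargement A \<epsilon> = {x \<in> M. \<exists>y\<in>A. d x y < \<epsilon>}"

text \<open>For probability measures the set below contains \<open>1\<close> and is bounded below by \<open>0\<close>,
  so its real infimum is meaningful.\<close>

definition prohorov_dist :: "'a measure \<Rightarrow> 'a measure \<Rightarrow> real" where
  "prohorov_dist \<mu> \<nu> = Inf {\<epsilon>. 0 < \<epsilon> \<and>
     (\<forall>A. closedin mtopology A \<longrightarrow>
        measure \<mu> A \<le> measure \<nu> (enlargement A \<epsilon>) + \<epsilon> \<and>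
        measure \<nu> A \<le> measure \<mu> (enlargement A \<epsilon>) + \<epsilon>)}"

text \<open>The library's \<^const>\<open>weak_conv_m\<close> is defined through distribution functions and
  only applies to measures on the real line. The limes superior is taken in the extended
  reals, where it always exists.\<close>

definition weakly_converges :: "(nat \<Rightarrow> 'a measure) \<Rightarrow> 'a measure \<Rightarrow> bool" where
  "weakly_converges \<mu>s \<mu> \<longleftrightarrow>
     (\<forall>C. closedin mtopology C \<longrightarrow>
        limsup (\<lambda>n. ereal (measure (\<mu>s n) C)) \<le> ereal (measure \<mu> C))"

end

end

theory Submission
  imports Defs
begin

text \<open>By separability, finitely many balls of radius \<open>\<epsilon>/2\<close> carry all but \<open>\<epsilon>/2\<close> of the
  mass of \<open>\<mu>\<close>. The unions of subfamilies of these balls are finitely many open sets, so for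
  large \<open>n\<close> weak convergence gives \<open>\<mu>(G) < \<mu>\<^sub>n(G) + \<epsilon>/2\<close> simultaneously for all of them. Given a
  closed \<open>A\<close>, take for \<open>G\<close> the union of those balls that meet \<open>A\<close>: it lies in \<open>A\<^sup>\<epsilon>\<close> and covers
  \<open>A\<close> up to \<open>\<mu>\<close>-mass \<open>\<epsilon>/2\<close>. The inequality with \<open>\<mu>\<close> and \<open>\<mu>\<^sub>n\<close> exchanged follows by
  applying this one to the complement of \<open>A\<^sup>\<epsilon>\<close>.\<close>

context Metric_space
begin

lemma space_borel_field [simp]: "space borel_field = M"
  unfolding borel_field_def using openin_subset[of mtopology]
  by (intro space_measure_of) auto

lemma space_eq_if_sets_borel_field: "sets P = sets borel_field \<Longrightarrow> space P = M"
  using sets_eq_imp_space_eq[of P borel_field] by simp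

lemma borel_field_open: "openin mtopology U \<Longrightarrow> U \<in> sets borel_field"
  unfolding borel_field_def using openin_subset[of mtopology]
  by (subst sets_measure_of) auto

lemma borel_field_closed:
  assumes "closedin mtopology C" shows "C \<in> sets borel_field"
proof -
  have "M - (M - C) \<in> sets borel_field"
    using sets.compl_sets[of "M - C" borel_field] assms
    by (auto simp: closedin_def intro: borel_field_open)
  moreover have "M - (M - C) = C"
    using closedin_subset[OF assms] by auto
  ultimately show ?thesis by simp
qed

lemma enlargement_eq_Union_mball:
  assumes "A \<subseteq> M" shows "enlargement A \<epsilon> = (\<Union>y\<in>A. mball y \<epsilon>)"
  using assms unfolding enlargement_def in_mball set_eq_iff UN_iff mem_Collect_eq
  by (metis commute subsetD)

lemma openin_enlargement:
  assumes "A \<subseteq> M" shows "openin mtopology (enlargement A \<epsilon>)"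
  unfolding enlargement_eq_Union_mball[OF assms] by (auto intro: openin_Union)

text \<open>A point outside \<open>enlargement A \<epsilon>\<close> has distance at least \<epsilon>
  from every point of \<open>A\<close>, so the enlargement of the complement \<open>B\<close> misses
  \<open>A\<close>. The hypothesis for \<open>B\<close>, rewritten through complements in both
  measures, becomes the claim.\<close>

lemma prohorov_one_sided_swap:
  assumes P: "prob_space P" "sets P = sets borel_field"
    and Q: "prob_space Q" "sets Q = sets borel_field"
    and PQ: "\<And>B. closedin mtopology B \<Longrightarrow> measure P B \<le> measure Q (enlargement B \<epsilon>) + \<epsilon>"
    and A: "closedin mtopology A"
  shows "measure Q A \<le> measure P (enlargement A \<epsilon>) + \<epsilon>"
proof -
  interpret P: prob_space P by fact
  interpret Q: prob_space Q by fact
  have sp: "space P = M" "space Q = M"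
    using P(2) Q(2) by (simp_all add: space_eq_if_sets_borel_field)
  have AM: "A \<subseteq> M" using closedin_subset[OF A] by simp
  have opA: "openin mtopology (enlargement A \<epsilon>)" by (rule openin_enlargement[OF AM])
  define B where "B = M - enlargement A \<epsilon>"
  have B: "closedin mtopology B"
    unfolding B_def using closedin_diff[OF closedin_topspace opA] by simp
  have "enlargement B \<epsilon> \<subseteq> M - A"
    using AM unfolding enlargement_def B_def by (auto, metis commute)
  then have "measure Q (enlargement B \<epsilon>) \<le> measure Q (M - A)"
    using borel_field_closed[OF A] sets.compl_sets[of A Q]
    by (intro Q.finite_measure_mono) (auto simp: Q sp)
  also have "\<dots> = 1 - measure Q A"
    using Q.prob_compl[of A] borel_field_closed[OF A] by (simp add: Q sp)
  finally have "measure Q (enlargement B \<epsilon>) \<le> 1 - measure Q A" .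
  moreover have "measure P B = 1 - measure P (enlargement A \<epsilon>)"
    unfolding B_def using P.prob_compl borel_field_open[OF opA] by (simp add: P sp)
  ultimately show ?thesis using PQ[OF B] by linarith
qed

text \<open>The swap lemma supplies the other half of the condition, so \<epsilon> itself belongs to
  the set whose infimum is the distance.\<close>

lemma prohorov_dist_bounds:
  assumes P: "prob_space P" "sets P = sets borel_field"
    and Q: "prob_space Q" "sets Q = sets borel_field"
    and "0 < \<epsilon>"
    and PQ: "\<And>A. closedin mtopology A \<Longrightarrow> measure Q A \<le> measure P (enlargement A \<epsilon>) + \<epsilon>"
  shows "0 \<le> prohorov_dist P Q" "prohorov_dist P Q \<le> \<epsilon>"
proof -
  let ?S = "{\<epsilon>. 0 < \<epsilon> \<and> (\<forall>A. closedin mtopology A \<longrightarrow>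
        measure P A \<le> measure Q (enlargement A \<epsilon>) + \<epsilon> \<and>
        measure Q A \<le> measure P (enlargement A \<epsilon>) + \<epsilon>)}"
  have S: "\<epsilon> \<in> ?S"
    using PQ prohorov_one_sided_swap[OF Q P PQ] \<open>0 < \<epsilon>\<close> by blast
  \<comment> \<open>\<open>S\<close> also provides nonemptiness here: a lower bound on all elements
    passes to a real \<open>Inf\<close> only for a nonempty set.\<close>
  show "0 \<le> prohorov_dist P Q" unfolding prohorov_dist_def
    by (rule cInf_greatest) (use S in blast, simp)
  show "prohorov_dist P Q \<le> \<epsilon>" unfolding prohorov_dist_def
    by (rule cInf_lower[OF S]) (auto intro: bdd_belowI[of _ 0])
qed

text \<open>Complementation turns the limsup bound on the closed set \<open>M - G\<close> into a
  lower bound on \<open>G\<close>. The slack \<epsilon> makes the bound on the limsup strict, so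
  that the terms themselves eventually satisfy it.\<close>

lemma weakly_converges_open:
  assumes "prob_space \<mu>" "sets \<mu> = sets borel_field"
    and "\<And>n. n \<ge> 1 \<Longrightarrow> prob_space (\<mu>s n)"
    and "\<And>n. n \<ge> 1 \<Longrightarrow> sets (\<mu>s n) = sets borel_field"
    and "weakly_converges \<mu>s \<mu>" and G: "openin mtopology G" and "0 < \<epsilon>"
  shows "\<forall>\<^sub>F n in sequentially. measure \<mu> G < measure (\<mu>s n) G + \<epsilon>"
proof -
  have compl: "measure N (M - G) = 1 - measure N G"
    if "prob_space N" "sets N = sets borel_field" for N
    using prob_space.prob_compl[OF that(1), of G] borel_field_open[OF G] that(2)
      space_eq_if_sets_borel_field[OF that(2)] by simp
  have "closedin mtopology (M - G)"
    using closedin_diff[OF closedin_topspace G] by simp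
  then have "limsup (\<lambda>n. ereal (measure (\<mu>s n) (M - G))) \<le> ereal (measure \<mu> (M - G))"
    using assms by (simp add: weakly_converges_def)
  also have "\<dots> < ereal (measure \<mu> (M - G) + \<epsilon>)" using \<open>0 < \<epsilon>\<close> by simp
  finally have "\<forall>\<^sub>F n in sequentially.
      ereal (measure (\<mu>s n) (M - G)) < ereal (measure \<mu> (M - G) + \<epsilon>)"
    by (rule Limsup_lessD)
  \<comment> \<open>The restriction to \<open>n \<ge> 1\<close> makes \<open>\<mu>s n\<close> a
    probability measure, as \<open>compl\<close> requires.\<close>
  then show ?thesis using eventually_ge_at_top[of 1]
  proof eventually_elim
    case (elim n)
    then show ?case using assms by (simp add: compl)
  qed
qed

text \<open>The balls of radius \<open>r\<close> around a countable dense set cover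
  \<open>M\<close>; by continuity from below, the measures of their finite unions increase to
  1.\<close>

lemma separable_finite_balls_measure:
  assumes sep: "separable_space mtopology"
    and P: "prob_space P" "sets P = sets borel_field"
    and "0 < r" "0 < \<delta>"
  obtains F where "finite F" "F \<subseteq> M" "1 - \<delta> < measure P (\<Union>x\<in>F. mball x r)"
proof -
  interpret P: prob_space P by fact
  have sp: "space P = M" using P(2) by (rule space_eq_if_sets_borel_field)
  obtain D where D: "countable D" "D \<subseteq> M" "mtopology closure_of D = M"
    using sep by (auto simp: separable_space_def)
  \<comment> \<open>Total mass 1 rules out an empty space, and \<open>from_nat_into D\<close> is
    guaranteed to take its values in \<open>D\<close> only when \<open>D\<close> is
    nonempty.\<close>
  have "M \<noteq> {}" using P.not_empty sp by simp
  then have "D \<noteq> {}" using D by auto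
  define U where "U n = (\<Union>i\<le>n. mball (from_nat_into D i) r)" for n
  have U: "U n \<in> sets P" for n
    unfolding U_def P by (intro sets.finite_UN borel_field_open) auto
  have "incseq U" unfolding U_def by (intro incseq_SucI) (auto simp: le_Suc_eq)
  have "(\<Union>n. U n) = M"
  proof
    show "(\<Union>n. U n) \<subseteq> M" by (auto simp: U_def)
    show "M \<subseteq> (\<Union>n. U n)"
    proof
      fix x assume x: "x \<in> M"
      then obtain y where "y \<in> D" "y \<in> mball x r"
        using D(3) \<open>0 < r\<close> by (auto simp: metric_closure_of)
      moreover obtain i where "y = from_nat_into D i"
        using from_nat_into_surj[OF D(1) \<open>y \<in> D\<close>] by metis
      ultimately have "x \<in> U i" by (auto simp: U_def commute)
      then show "x \<in> (\<Union>n. U n)" by blast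
    qed
  qed
  then have "(\<lambda>n. measure P (U n)) \<longlonglongrightarrow> 1"
    using P.finite_Lim_measure_incseq[OF _ \<open>incseq U\<close>] U P.prob_space sp by auto
  then have "\<forall>\<^sub>F n in sequentially. 1 - \<delta> < measure P (U n)"
    using \<open>0 < \<delta>\<close> by (intro order_tendstoD(1)) auto
  then obtain n where "1 - \<delta> < measure P (U n)"
    using eventually_happens by fastforce
  moreover have "U n = (\<Union>x\<in>from_nat_into D ` {..n}. mball x r)" by (simp add: U_def)
  moreover have "from_nat_into D ` {..n} \<subseteq> M"
    using from_nat_into[OF \<open>D \<noteq> {}\<close>] D(2) by auto
  ultimately show thesis by (intro that[of "from_nat_into D ` {..n}"]) auto
qed

text \<open>The point is uniformity: one threshold for \<open>n\<close> serves all closed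
  \<open>A\<close>. The family \<open>F\<close> is fixed before \<open>n\<close> and
  \<open>A\<close>, and \<open>A\<close> selects only one of the finitely many subsets of
  \<open>F\<close>.\<close>

lemma weakly_converges_enlargement:
  assumes sep: "separable_space mtopology"
    and \<mu>: "prob_space \<mu>" "sets \<mu> = sets borel_field"
    and \<mu>s: "\<And>n. n \<ge> 1 \<Longrightarrow> prob_space (\<mu>s n)"
      "\<And>n. n \<ge> 1 \<Longrightarrow> sets (\<mu>s n) = sets borel_field"
    and wc: "weakly_converges \<mu>s \<mu>" and "0 < \<epsilon>"
  shows "\<forall>\<^sub>F n in sequentially. \<forall>A. closedin mtopology A \<longrightarrow>
    measure \<mu> A \<le> measure (\<mu>s n) (enlargement A \<epsilon>) + \<epsilon>"
proof -
  interpret \<mu>: prob_space \<mu> by fact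
  have sp: "space \<mu> = M" using \<mu>(2) by (rule space_eq_if_sets_borel_field)
  define G where "G F = (\<Union>x\<in>F. mball x (\<epsilon>/2))" for F
  have G: "openin mtopology (G F)" for F unfolding G_def by auto
  obtain F where F: "finite F" "F \<subseteq> M" "1 - \<epsilon>/2 < measure \<mu> (G F)"
    using separable_finite_balls_measure[OF sep \<mu>, of "\<epsilon>/2" "\<epsilon>/2"] \<open>0 < \<epsilon>\<close>
    unfolding G_def by auto
  have "\<forall>\<^sub>F n in sequentially. \<forall>J\<in>Pow F. measure \<mu> (G J) < measure (\<mu>s n) (G J) + \<epsilon>/2"
    using F(1) \<open>0 < \<epsilon>\<close> weakly_converges_open[OF \<mu> \<mu>s wc G]
    by (intro eventually_ball_finite) auto
  then show ?thesis using eventually_ge_at_top[of 1]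
  proof eventually_elim
    case (elim n)
    show ?case
    proof (intro allI impI)
      fix A assume A: "closedin mtopology A"
      then have AM: "A \<subseteq> M" using closedin_subset by fastforce
      interpret \<mu>n: prob_space "\<mu>s n" using \<mu>s elim by simp
      define J where "J = {x\<in>F. mball x (\<epsilon>/2) \<inter> A \<noteq> {}}"
      \<comment> \<open>Two points of a ball of radius \<open>\<epsilon>/2\<close> are less than
        \<epsilon> apart, so a ball meeting \<open>A\<close> stays inside the enlargement.\<close>
      have GJ: "G J \<subseteq> enlargement A \<epsilon>"
      proof
        fix y assume "y \<in> G J"
        then obtain x a where "x \<in> M" "a \<in> A" "y \<in> M" "d x a < \<epsilon>/2" "d x y < \<epsilon>/2"
          by (auto simp: G_def J_def)
        moreover then have "d y a \<le> d x y + d x a"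
          using triangle[of y x a] AM by (auto simp: commute)
        ultimately have "d y a < \<epsilon>" by linarith
        with \<open>a \<in> A\<close> \<open>y \<in> M\<close> show "y \<in> enlargement A \<epsilon>" by (auto simp: enlargement_def)
      qed
      have meas: "G J \<in> sets \<mu>" "G F \<in> sets \<mu>"
        using borel_field_open[OF G] \<mu>(2) by auto
      \<comment> \<open>A point of \<open>A\<close> in \<open>G F\<close> lies in a ball that
        thereby meets \<open>A\<close>, so its centre is in \<open>J\<close>. The other points of
        \<open>A\<close> lie in \<open>M - G F\<close>, of mass below
        \<open>\<epsilon>/2\<close>.\<close>
      have "A \<subseteq> G J \<union> (M - G F)" using AM by (auto simp: G_def J_def)
      then have "measure \<mu> A \<le> measure \<mu> (G J \<union> (M - G F))"
        using meas sp by (intro \<mu>.finite_measure_mono) auto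
      also have "\<dots> \<le> measure \<mu> (G J) + measure \<mu> (M - G F)"
        using meas sp by (intro measure_Un_le) auto
      also have "measure \<mu> (M - G F) = 1 - measure \<mu> (G F)"
        using \<mu>.prob_compl[OF meas(2)] sp by simp
      also have "measure \<mu> (G J) < measure (\<mu>s n) (G J) + \<epsilon>/2"
        using elim by (auto simp: J_def)
      also have "measure (\<mu>s n) (G J) \<le> measure (\<mu>s n) (enlargement A \<epsilon>)"
        using GJ borel_field_open[OF openin_enlargement[OF AM]] \<mu>s(2)[OF elim(2)]
        by (intro \<mu>n.finite_measure_mono) auto
      finally show "measure \<mu> A \<le> measure (\<mu>s n) (enlargement A \<epsilon>) + \<epsilon>"
        using F(3) by simp
    qed
  qed
qed

end

theorem theorem2p2:
  fixes M :: "'a set" and d :: "'a \<Rightarrow> 'a \<Rightarrow> real"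
    and \<mu> :: "'a measure" and \<mu>s :: "nat \<Rightarrow> 'a measure"
  assumes "Metric_space M d"
    and "separable_space (Metric_space.mtopology M d)"
    and "prob_space \<mu>" and "sets \<mu> = sets (Metric_space.borel_field M d)"
    and "\<And>n. n \<ge> 1 \<Longrightarrow> prob_space (\<mu>s n)"
    and "\<And>n. n \<ge> 1 \<Longrightarrow> sets (\<mu>s n) = sets (Metric_space.borel_field M d)"
    and "Metric_space.weakly_converges M d \<mu>s \<mu>"
  shows "(\<lambda>n. Metric_space.prohorov_dist M d (\<mu>s n) \<mu>) \<longlonglongrightarrow> 0"
proof (rule tendstoI)
  interpret Metric_space M d by fact
  fix e :: real assume "0 < e"
  \<comment> \<open>The distance will be bounded by \<open>\<le>\<close> only; halving
    \<open>e\<close> yields the strict inequality that convergence asks for.\<close>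
  then have "0 < e/2" by simp
  have "\<forall>\<^sub>F n in sequentially. \<forall>A. closedin mtopology A \<longrightarrow>
      measure \<mu> A \<le> measure (\<mu>s n) (enlargement A (e/2)) + e/2"
    using assms(2-7) \<open>0 < e/2\<close> by (rule weakly_converges_enlargement)
  then show "\<forall>\<^sub>F n in sequentially. dist (prohorov_dist (\<mu>s n) \<mu>) 0 < e"
    using eventually_ge_at_top[of 1]
  proof eventually_elim
    case (elim n)
    have "0 \<le> prohorov_dist (\<mu>s n) \<mu>" "prohorov_dist (\<mu>s n) \<mu> \<le> e/2"
      using prohorov_dist_bounds[OF assms(5,6)[OF elim(2)] assms(3,4) \<open>0 < e/2\<close>] elim(1) by auto
    then show ?case using \<open>0 < e\<close> by simp
  qed
qed

end
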